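(* Let $(\mathfrak g,J,g)$ be a Kähler Lie algebra and assume that $\mathfrak h$ is an ideal satisfying $J\mathfrak h=\mathfrak h^\perp$ and $\mathfrak h\cap J\mathfrak h=0$. Let $\nabla$ be the Levi-Civita connection of $g$. Then for all $x,y\in\mathfrak h$: - $\nabla_xy\in J\mathfrak h$; - $\nabla_{Jx}Jy\in J\mathfrak h$; - $\nabla_xJy\in\mathfrak h$ and $\nabla_{Jx}y\in\mathfrak h$. Thus the subgroup corresponding to $J\mathfrak h$ on the Lie group $G$ is totally geodesic.
   Context: All Lie algebras are real and finite dimensional. A complex structure is an endomorphism $J$ with $J^2=-I$ and $[Jx,Jy]-[x,y]-J[Jx,y]-J[x,Jy]=0$. A Kähler Lie algebra is a Lie algebra with a complex structure $J$ and a closed nondegenerate 2-form $\omega$ (closed: $\omega([x,y],z)+\omega([y,z],x)+\omega([z,x],y)=0$) with $\omega(Jx,Jy)=\omega(x,y)$; the associated pseudo-Kähler metric is $g(x,y)=\omega(Jx,y)$, not necessarily definite, and one writes $(\mathfrak g,J,g)$. $\mathfrak h^\perp$ is the orthogonal with respect to $g$. The Levi-Civita connection on $\mathfrak g$ is given by $2g(\nabla_xy,z)=g([x,y],z)-g([y,z],x)+g([z,x],y)$. $G$ is the simply connected Lie group with Lie algebra $\mathfrak g$, with the left invariant metric induced by $g$. A subgroup with Lie algebra $\mathfrak w$ is totally geodesic if $\nabla_uv\in\mathfrak w$ for all $u,v\in\mathfrak w$. *)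

theory Defs
  imports "HOL-Analysis.Analysis"
begin

text \<open>
  The underlying vector space of a Lie algebra is a whole type of class \<open>real_vector\<close>, made finite
  dimensional by hypothesis. The class \<open>euclidean_space\<close> is avoided because it carries a
  distinguished inner product and excludes dimension 0.
\<close>

definition lie_algebra :: "('a::real_vector \<Rightarrow> 'a \<Rightarrow> 'a) \<Rightarrow> bool" where
  "lie_algebra br \<longleftrightarrow>
     (\<exists>B::'a set. finite B \<and> span B = UNIV) \<and>
     bilinear br \<and>
     (\<forall>x. br x x = 0) \<and>
     (\<forall>x y z. br x (br y z) + br y (br z x) + br z (br x y) = 0)"

definition lie_subalgebra :: "('a::real_vector \<Rightarrow> 'a \<Rightarrow> 'a) \<Rightarrow> 'a set \<Rightarrow> bool" where
  "lie_subalgebra br w \<longleftrightarrow> subspace w \<and> (\<forall>x\<in>w. \<forall>y\<in>w. br x y \<in> w)"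

definition lie_ideal :: "('a::real_vector \<Rightarrow> 'a \<Rightarrow> 'a) \<Rightarrow> 'a set \<Rightarrow> bool" where
  "lie_ideal br h \<longleftrightarrow> subspace h \<and> (\<forall>x. \<forall>y\<in>h. br x y \<in> h)"

definition complex_structure ::
    "('a::real_vector \<Rightarrow> 'a \<Rightarrow> 'a) \<Rightarrow> ('a \<Rightarrow> 'a) \<Rightarrow> bool" where
  "complex_structure br J \<longleftrightarrow>
     linear J \<and>
     (\<forall>x. J (J x) = - x) \<and>
     (\<forall>x y. br (J x) (J y) - br x y - J (br (J x) y) - J (br x (J y)) = 0)"

definition two_form :: "('a::real_vector \<Rightarrow> 'a \<Rightarrow> real) \<Rightarrow> bool" where
  "two_form \<omega> \<longleftrightarrow> bilinear \<omega> \<and> (\<forall>x. \<omega> x x = 0)"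

definition closed_form ::
    "('a::real_vector \<Rightarrow> 'a \<Rightarrow> 'a) \<Rightarrow> ('a \<Rightarrow> 'a \<Rightarrow> real) \<Rightarrow> bool" where
  "closed_form br \<omega> \<longleftrightarrow>
     (\<forall>x y z. \<omega> (br x y) z + \<omega> (br y z) x + \<omega> (br z x) y = 0)"

definition nondegenerate :: "('a::real_vector \<Rightarrow> 'a \<Rightarrow> real) \<Rightarrow> bool" where
  "nondegenerate b \<longleftrightarrow> (\<forall>x. (\<forall>y. b x y = 0) \<longrightarrow> x = 0)"

definition kahler_lie_algebra ::
    "('a::real_vector \<Rightarrow> 'a \<Rightarrow> 'a) \<Rightarrow> ('a \<Rightarrow> 'a) \<Rightarrow> ('a \<Rightarrow> 'a \<Rightarrow> real) \<Rightarrow> bool" where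
  "kahler_lie_algebra br J \<omega> \<longleftrightarrow>
     lie_algebra br \<and> complex_structure br J \<and>
     two_form \<omega> \<and> closed_form br \<omega> \<and> nondegenerate \<omega> \<and>
     (\<forall>x y. \<omega> (J x) (J y) = \<omega> x y)"

text \<open>The associated pseudo-Kaehler metric, in general indefinite.\<close>

definition kahler_metric ::
    "('a::real_vector \<Rightarrow> 'a) \<Rightarrow> ('a \<Rightarrow> 'a \<Rightarrow> real) \<Rightarrow> 'a \<Rightarrow> 'a \<Rightarrow> real" where
  "kahler_metric J \<omega> = (\<lambda>x y. \<omega> (J x) y)"

text \<open>
  Orthogonality with respect to a given form \<open>g\<close>; the library's \<open>orthogonal_comp\<close> refers to the
  inner product of the type class and does not apply to an indefinite metric.
\<close>

definition perp :: "('a::real_vector \<Rightarrow> 'a \<Rightarrow> real) \<Rightarrow> 'a set \<Rightarrow> 'a set" where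
  "perp g h = {v. \<forall>u\<in>h. g v u = 0}"

definition koszul ::
    "('a::real_vector \<Rightarrow> 'a \<Rightarrow> 'a) \<Rightarrow> ('a \<Rightarrow> 'a \<Rightarrow> real) \<Rightarrow> 'a \<Rightarrow> 'a \<Rightarrow> 'a \<Rightarrow> bool" where
  "koszul br g x y v \<longleftrightarrow>
     (\<forall>z. 2 * g v z = g (br x y) z - g (br y z) x + g (br z x) y)"

definition levi_civita ::
    "('a::real_vector \<Rightarrow> 'a \<Rightarrow> 'a) \<Rightarrow> ('a \<Rightarrow> 'a \<Rightarrow> real) \<Rightarrow> 'a \<Rightarrow> 'a \<Rightarrow> 'a" where
  "levi_civita br g x y = (THE v. koszul br g x y v)"

text \<open>
  A Lie subalgebra \<open>w\<close> is the Lie algebra of a unique connected subgroup of the simply connected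
  Lie group of \<open>br\<close>. The left invariant metric induced by \<open>g\<close> has a left invariant Levi-Civita
  connection, so the subgroup being totally geodesic is the following condition on \<open>w\<close>.
\<close>

definition totally_geodesic ::
    "('a::real_vector \<Rightarrow> 'a \<Rightarrow> 'a) \<Rightarrow> ('a \<Rightarrow> 'a \<Rightarrow> real) \<Rightarrow> 'a set \<Rightarrow> bool" where
  "totally_geodesic br g w \<longleftrightarrow>
     lie_subalgebra br w \<and> (\<forall>u\<in>w. \<forall>v\<in>w. levi_civita br g u v \<in> w)"

text \<open>
  The description defining \<open>levi_civita\<close> denotes: by nondegeneracy and finite dimension the Koszul
  formula has exactly one solution.
\<close>

lemma ex1_representing_vector:
  fixes g :: "'a::real_vector \<Rightarrow> 'a \<Rightarrow> real"
  assumes fin: "\<exists>B::'a set. finite B \<and> span B = UNIV"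
    and bil: "bilinear g" and nd: "nondegenerate g" and lin: "linear f"
  shows "\<exists>!v. \<forall>z. g v z = f z"
proof -
  obtain S :: "'a set" where S: "finite S" "span S = UNIV"
    using fin by blast
  obtain B where B: "B \<subseteq> S" "independent B" "S \<subseteq> span B"
    using maximal_independent_subset by blast
  have finB: "finite B" using B(1) S(1) finite_subset by blast
  have spB: "span B = UNIV" using B(3) S(2) by (metis span_minimal subspace_span top.extremum_uniqueI)
  interpret fd: finite_dimensional_vector_space "scaleR :: real \<Rightarrow> 'a \<Rightarrow> 'a" B
    using finB B(2) spB by unfold_locales (auto simp: dependent_raw_def span_raw_def)
  have lin1: "linear (\<lambda>v. g v z)" for z using bil by (simp add: bilinear_def)
  have lin2: "linear (\<lambda>z. g v z)" for v using bil by (simp add: bilinear_def)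
  define T where "T v = (\<Sum>b\<in>B. g v b *\<^sub>R b)" for v
  have linT: "linear T"
    unfolding T_def
    by (rule linearI)
       (simp_all add: linear_add[OF lin1] linear_scale[OF lin1] scaleR_add_left sum.distrib
          scaleR_sum_right)
  have coords: "(\<forall>b\<in>B. p b = q b)" if "(\<Sum>b\<in>B. p b *\<^sub>R b) = (\<Sum>b\<in>B. q b *\<^sub>R b)" for p q
  proof -
    have "(\<Sum>b\<in>B. (p b - q b) *\<^sub>R b) = 0"
      using that by (simp add: scaleR_diff_left sum_subtractf)
    then show ?thesis
      using independentD[OF B(2) finB subset_refl, of "\<lambda>b. p b - q b"] by auto
  qed
  have ext: "(\<forall>z. g v z = F z)" if "\<forall>b\<in>B. g v b = F b" "linear F" for v F
    using linear_eq_on[OF lin2 that(2)] that(1) spB by (metis UNIV_I)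
  have uniq: "v = w" if "\<forall>z. g v z = g w z" for v w
  proof -
    have "\<forall>z. g (v - w) z = 0" using that by (simp add: linear_diff[OF lin1])
    then show ?thesis using nd by (force simp: nondegenerate_def)
  qed
  have "inj T"
  proof (rule injI)
    fix v w assume "T v = T w"
    then have "\<forall>b\<in>B. g v b = g w b" unfolding T_def by (rule coords)
    then show "v = w" using ext[OF _ lin2] uniq by blast
  qed
  then have "surj T"
    using linT by (intro fd.linear_inj_imp_surj) (simp_all add: linear_def real_scaleR_def)
  then obtain v where "T v = (\<Sum>b\<in>B. f b *\<^sub>R b)" by (metis surjD)
  then have "\<forall>b\<in>B. g v b = f b" unfolding T_def by (rule coords)
  then have "\<forall>z. g v z = f z" using ext lin by blast
  then show ?thesis using uniq by (metis (no_types, lifting))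
qed

lemma ex1_koszul:
  fixes br :: "'a::real_vector \<Rightarrow> 'a \<Rightarrow> 'a"
  assumes "kahler_lie_algebra br J \<omega>"
  shows "\<exists>!v. koszul br (kahler_metric J \<omega>) x y v"
proof -
  let ?g = "kahler_metric J \<omega>"
  from assms have fin: "\<exists>B::'a set. finite B \<and> span B = UNIV" and br: "bilinear br"
    and J: "linear J" "\<And>x. J (J x) = - x" and w: "bilinear \<omega>" "nondegenerate \<omega>"
    by (auto simp: kahler_lie_algebra_def lie_algebra_def complex_structure_def two_form_def)
  have bil: "bilinear ?g"
    unfolding kahler_metric_def bilinear_def
    using w(1) J(1) linear_compose[of J] by (auto simp: bilinear_def o_def)
  have nd: "nondegenerate ?g"
    unfolding nondegenerate_def kahler_metric_def
    by (metis J(2) J(1) linear_0 neg_equal_0_iff_equal nondegenerate_def w(2))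
  have "linear (\<lambda>z. (1/2) * (?g (br x y) z - ?g (br y z) x + ?g (br z x) y))"
    by (rule linearI)
       (simp_all add: bilinear_radd[OF bil] bilinear_ladd[OF bil] bilinear_rmul[OF bil]
         bilinear_lmul[OF bil] bilinear_radd[OF br] bilinear_ladd[OF br] bilinear_rmul[OF br]
         bilinear_lmul[OF br] algebra_simps add_divide_distrib)
  from ex1_representing_vector[OF fin bil nd this]
  show ?thesis by (simp add: koszul_def field_simps)
qed

end

theory Submission
  imports Defs
begin

text \<open>
  Since \<open>g (J x) y = - \<omega> x y\<close>, the hypothesis \<open>J ` h = perp g h\<close> says that \<open>h\<close> is Lagrangian for
  \<open>\<omega>\<close>. A Lagrangian ideal is abelian: for \<open>x, y \<in> h\<close> closedness reduces to \<open>\<omega> (br x y) z = 0\<close> for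
  all \<open>z\<close>, the other two terms pairing elements of \<open>h\<close> with each other. Vanishing of the Nijenhuis
  tensor then turns into \<open>br (J x) (J y) = J (br (J x) y + br x (J y))\<close>, so \<open>J ` h\<close> is a subalgebra.
  Hence every bracket of two elements of \<open>h \<union> J ` h\<close> is known to lie in \<open>h\<close> or in \<open>J ` h\<close>.

  Because \<open>J\<close> is a \<open>g\<close>-isometry, the roles of \<open>h\<close> and \<open>J ` h\<close> can be exchanged: \<open>h = perp g (J ` h)\<close>.
  Membership of a covariant derivative in \<open>J ` h\<close> or in \<open>h\<close> is therefore tested by pairing it with
  \<open>h\<close> or with \<open>J ` h\<close> respectively, and in each of these cases all three terms of the
  Koszul formula vanish separately.
\<close>

lemma koszul_levi_civita:
  assumes "kahler_lie_algebra br J \<omega>"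
  shows "koszul br (kahler_metric J \<omega>) x y (levi_civita br (kahler_metric J \<omega>) x y)"
  unfolding levi_civita_def by (rule theI'[OF ex1_koszul[OF assms]])

lemma levi_civita_mem_perp:
  assumes "kahler_lie_algebra br J \<omega>" and "g = kahler_metric J \<omega>"
    and "\<And>z. z \<in> w \<Longrightarrow> g (br x y) z = 0 \<and> g (br y z) x = 0 \<and> g (br z x) y = 0"
  shows "levi_civita br g x y \<in> perp g w"
proof -
  have "2 * g (levi_civita br g x y) z = g (br x y) z - g (br y z) x + g (br z x) y" for z
    using koszul_levi_civita[OF assms(1), of x y] by (simp add: koszul_def assms(2))
  then have "g (levi_civita br g x y) z = 0" if "z \<in> w" for z
    using assms(3)[OF that] by (metis add_0 diff_0_right mult_eq_0_iff zero_neq_numeral)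
  then show ?thesis
    by (simp add: perp_def)
qed

lemma alternating_bilinear_skew:
  assumes b: "bilinear b" and z: "\<And>x. b x x = 0"
  shows "b x y = - b y x"
proof -
  have "b (x + y) (x + y) = b x y + b y x"
    by (simp add: bilinear_ladd[OF b] bilinear_radd[OF b] z[of x] z[of y])
  then have "b x y + b y x = 0"
    by (simp only: z)
  then show ?thesis by (simp only: eq_neg_iff_add_eq_0)
qed

lemma kahler_two_form_skew:
  assumes "kahler_lie_algebra br J \<omega>"
  shows "\<omega> x y = - \<omega> y x"
  using assms by (intro alternating_bilinear_skew) (auto simp: kahler_lie_algebra_def two_form_def)

lemma kahler_two_form_J_left:
  assumes "kahler_lie_algebra br J \<omega>"
  shows "\<omega> (J x) y = - \<omega> x (J y)"
proof -
  have b: "bilinear \<omega>" and J: "\<And>x. J (J x) = - x" and inv: "\<And>x y. \<omega> (J x) (J y) = \<omega> x y"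
    using assms by (auto simp: kahler_lie_algebra_def complex_structure_def two_form_def)
  have "\<omega> (J x) y = \<omega> (J (J x)) (J y)" by (simp only: inv)
  then show ?thesis by (simp add: J bilinear_lneg[OF b])
qed

lemma kahler_metric_sym:
  assumes "kahler_lie_algebra br J \<omega>"
  shows "kahler_metric J \<omega> x y = kahler_metric J \<omega> y x"
  using kahler_two_form_J_left[OF assms, of x y] kahler_two_form_skew[OF assms, of x "J y"]
  by (simp add: kahler_metric_def)

lemma kahler_metric_J_left:
  assumes "kahler_lie_algebra br J \<omega>"
  shows "kahler_metric J \<omega> (J x) y = - kahler_metric J \<omega> x (J y)"
  using kahler_two_form_J_left[OF assms, of "J x" y] by (simp add: kahler_metric_def)

text \<open>
  A vector \<open>v\<close> is orthogonal to \<open>J ` h\<close> iff \<open>J v\<close> is orthogonal to \<open>h\<close>, that is, iff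
  \<open>J v \<in> J ` h\<close>; and \<open>J\<close> is injective. Going
  through \<open>J\<close> makes a count of dimensions unnecessary.
\<close>

lemma perp_J_image_eq:
  assumes K: "kahler_lie_algebra br J \<omega>" and g: "g = kahler_metric J \<omega>"
    and perp: "J ` h = perp g h"
  shows "perp g (J ` h) = h"
proof -
  have JJ: "\<And>x. J (J x) = - x"
    using K by (simp add: kahler_lie_algebra_def complex_structure_def)
  have "inj J"
    by (rule injI) (metis JJ neg_equal_iff_equal)
  have "v \<in> perp g (J ` h) \<longleftrightarrow> J v \<in> perp g h" for v
    by (auto simp: perp_def g kahler_metric_J_left[OF K])
  then show ?thesis
    unfolding perp[symmetric] using \<open>inj J\<close> by (auto simp: inj_image_mem_iff)
qed

text \<open>
  In the closedness identity for \<open>x, y \<in> h\<close> and arbitrary \<open>z\<close>, the brackets \<open>br y z\<close> and \<open>br z x\<close>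
  are in \<open>h\<close> and are paired with \<open>x\<close> and \<open>y\<close>, so isotropy leaves only \<open>\<omega> (br x y) z\<close>, and
  nondegeneracy applies.
\<close>

lemma isotropic_ideal_abelian:
  assumes K: "kahler_lie_algebra br J \<omega>" and ideal: "lie_ideal br h"
    and iso: "\<And>x y. x \<in> h \<Longrightarrow> y \<in> h \<Longrightarrow> \<omega> x y = 0"
    and x: "x \<in> h" and y: "y \<in> h"
  shows "br x y = 0"
proof -
  have closed: "\<And>x y z. \<omega> (br x y) z + \<omega> (br y z) x + \<omega> (br z x) y = 0"
    and nd: "nondegenerate \<omega>" and br: "bilinear br" and alt: "\<And>x. br x x = 0"
    using K by (auto simp: kahler_lie_algebra_def closed_form_def lie_algebra_def)
  have left: "br z u \<in> h" if "u \<in> h" for z u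
    using ideal that by (simp add: lie_ideal_def)
  have "br y z = - br z y" for z
    by (rule alternating_bilinear_skew[OF br alt])
  then have right: "br y z \<in> h" for z
    using left[OF y] ideal by (simp add: lie_ideal_def subspace_neg)
  have "\<omega> (br x y) z = 0" for z
    using closed[of x y z] iso[OF right x] iso[OF left[OF x] y] by simp
  then show ?thesis
    using nd by (simp add: nondegenerate_def)
qed

text \<open>
  With \<open>br x y = 0\<close> the integrability condition expresses \<open>br (J x) (J y)\<close> as \<open>J\<close> of a sum of two
  brackets, each having an entry in the ideal \<open>h\<close>.
\<close>

lemma J_image_abelian_ideal_subalgebra:
  assumes cs: "complex_structure br J" and ideal: "lie_ideal br h"
    and alt: "\<And>x y. br x y = - br y x"
    and abelian: "\<And>x y. x \<in> h \<Longrightarrow> y \<in> h \<Longrightarrow> br x y = 0"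
  shows "lie_subalgebra br (J ` h)"
  unfolding lie_subalgebra_def
proof (intro conjI ballI)
  have J: "linear J"
    and N: "\<And>x y. br (J x) (J y) - br x y - J (br (J x) y) - J (br x (J y)) = 0"
    using cs by (auto simp: complex_structure_def)
  have h: "subspace h" and left: "\<And>z u. u \<in> h \<Longrightarrow> br z u \<in> h"
    using ideal by (auto simp: lie_ideal_def)
  show "subspace (J ` h)"
    by (rule linear_subspace_image[OF J h])
  fix u v
  assume "u \<in> J ` h" "v \<in> J ` h"
  then obtain x y where x: "x \<in> h" "u = J x" and y: "y \<in> h" "v = J y"
    by blast
  have "br x (J y) \<in> h"
    using left[OF x(1)] alt[of x] h by (simp add: subspace_neg)
  then have "br (J x) y + br x (J y) \<in> h"
    using left[OF y(1)] h by (simp add: subspace_add)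
  moreover have "br u v = J (br (J x) y + br x (J y))"
    using N[of x y] abelian[OF x(1) y(1)] x(2) y(2) by (simp add: linear_add[OF J] algebra_simps)
  ultimately show "br u v \<in> J ` h"
    by blast
qed

theorem proposition4p1:
  fixes br :: "'a::real_vector \<Rightarrow> 'a \<Rightarrow> 'a"
    and J :: "'a \<Rightarrow> 'a"
    and \<omega> g :: "'a \<Rightarrow> 'a \<Rightarrow> real"
    and nabla :: "'a \<Rightarrow> 'a \<Rightarrow> 'a"
    and h :: "'a set"
  assumes "kahler_lie_algebra br J \<omega>"
    and "g = kahler_metric J \<omega>"
    and "lie_ideal br h"
    and "J ` h = perp g h"
    and "h \<inter> J ` h = {0}"
    and "nabla = levi_civita br g"
  shows "(\<forall>x\<in>h. \<forall>y\<in>h.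
            nabla x y \<in> J ` h \<and>
            nabla (J x) (J y) \<in> J ` h \<and>
            nabla x (J y) \<in> h \<and> nabla (J x) y \<in> h) \<and>
         totally_geodesic br g (J ` h)"
proof -
  note K = assms(1) and g = assms(2) and ideal = assms(3) and perp = assms(4) and nabla = assms(6)
  have br: "bilinear br" and br0: "\<And>x. br x x = 0" and cs: "complex_structure br J"
    and JJ: "\<And>x. J (J x) = - x" and \<omega>: "bilinear \<omega>"
    using K by (auto simp: kahler_lie_algebra_def lie_algebra_def complex_structure_def two_form_def)
  have h: "subspace h" and left: "\<And>z u. u \<in> h \<Longrightarrow> br z u \<in> h"
    using ideal by (auto simp: lie_ideal_def)
  have alt: "br x y = - br y x" for x y
    by (rule alternating_bilinear_skew[OF br br0])
  have right: "br u z \<in> h" if "u \<in> h" for u z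
    using left[OF that, of z] alt[of u z] h by (simp add: subspace_neg)
  have orth: "g (J x) y = 0" if "x \<in> h" "y \<in> h" for x y
    using that perp by (auto simp: perp_def)
  have orth': "g y (J x) = 0" if "x \<in> h" "y \<in> h" for x y
    using orth[OF that] kahler_metric_sym[OF K, of y "J x"] by (simp add: g)
  have isotropic: "\<omega> x y = 0" if "x \<in> h" "y \<in> h" for x y
    using orth[OF that] by (simp add: g kahler_metric_def JJ bilinear_lneg[OF \<omega>])
  have abelian: "br x y = 0" if "x \<in> h" "y \<in> h" for x y
    using isotropic_ideal_abelian[OF K ideal isotropic that] .
  have sub: "lie_subalgebra br (J ` h)"
    by (rule J_image_abelian_ideal_subalgebra[OF cs ideal alt abelian])
  have orth_bracket: "g (br (J x) (J y)) z = 0" if "x \<in> h" "y \<in> h" "z \<in> h" for x y z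
  proof -
    have "br (J x) (J y) \<in> J ` h"
      using sub that by (simp add: lie_subalgebra_def)
    then show ?thesis
      using perp that(3) by (auto simp: perp_def)
  qed
  have g0: "g 0 z = 0" for z
    using linear_0[of J] cs by (simp add: g kahler_metric_def complex_structure_def bilinear_lzero[OF \<omega>])
  have perp': "perp g (J ` h) = h"
    by (rule perp_J_image_eq[OF K g perp])
  have hh: "nabla x y \<in> J ` h" if "x \<in> h" "y \<in> h" for x y
    unfolding nabla perp using that
    by (intro levi_civita_mem_perp[OF K g]) (simp add: abelian g0)
  have JJh: "nabla (J x) (J y) \<in> J ` h" if "x \<in> h" "y \<in> h" for x y
    unfolding nabla perp using that
    by (intro levi_civita_mem_perp[OF K g]) (simp add: orth_bracket orth' left right)
  have hJ: "nabla x (J y) \<in> perp g (J ` h)" if "x \<in> h" "y \<in> h" for x y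
    unfolding nabla using that
    by (intro levi_civita_mem_perp[OF K g]) (auto simp: orth_bracket orth' left right)
  have Jh: "nabla (J x) y \<in> perp g (J ` h)" if "x \<in> h" "y \<in> h" for x y
    unfolding nabla using that
    by (intro levi_civita_mem_perp[OF K g]) (auto simp: orth_bracket orth' left right)
  have "totally_geodesic br g (J ` h)"
    using sub JJh by (auto simp: totally_geodesic_def nabla)
  then show ?thesis
    using hh JJh hJ Jh by (simp add: perp')
qed

end
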